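(* For every even integer $n\ge 0$ (and all $x$), $$\sum_{k=0}^{n}(-1)^k\binom{n}{k}B_{2,n-k}(x)\,B_{2,k}(x)=\frac12\,\delta_{n-2}+n\,B_{2,n-1}+B_{2,n}.$$
   Context: The hypergeometric Bernoulli polynomials $B_{2,n}(x)$ of order $2$ are defined by $$\frac{(t^2/2)\,e^{xt}}{e^t-1-t}=\sum_{n=0}^\infty B_{2,n}(x)\frac{t^n}{n!},$$ and $B_{2,n}=B_{2,n}(0)$, with $B_{2,n}(x)=0$ for $n<0$. $\delta_m$ equals $1$ if $m=0$ and $0$ otherwise. *)

theory Defs
  imports "HOL-Computational_Algebra.Formal_Power_Series"
begin

text \<open>
  Both \<open>t\<^sup>2/2\<close> and \<open>e\<^sup>t - 1 - t\<close> have subdegree 2, so the division of formal power series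
  below is exact; see \<open>hyp_bernoulli2_fps_mult\<close>.
\<close>

definition hyp_bernoulli2_fps :: "'a::field_char_0 \<Rightarrow> 'a fps" where
  "hyp_bernoulli2_fps x =
     (fps_const (1 / 2) * fps_X ^ 2 * fps_exp x) / (fps_exp 1 - 1 - fps_X)"

text \<open>The index is an integer because of the convention that \<open>B\<^bsub>2,n\<^esub>(x) = 0\<close> for \<open>n < 0\<close>.\<close>

definition hyp_bernoulli2_poly :: "int \<Rightarrow> 'a::field_char_0 \<Rightarrow> 'a" where
  "hyp_bernoulli2_poly n x =
     (if n < 0 then 0 else fact (nat n) * fps_nth (hyp_bernoulli2_fps x) (nat n))"

definition hyp_bernoulli2 :: "int \<Rightarrow> 'a::field_char_0" where
  "hyp_bernoulli2 n = hyp_bernoulli2_poly n 0"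

definition delta :: "int \<Rightarrow> 'a::zero_neq_one" where
  "delta m = (if m = 0 then 1 else 0)"

lemma subdegree_fps_exp_minus_one_minus_X:
  "subdegree (fps_exp 1 - 1 - fps_X :: 'a::field_char_0 fps) = 2"
proof (rule subdegreeI)
  show "fps_nth (fps_exp 1 - 1 - fps_X :: 'a fps) 2 \<noteq> 0"
    by (simp add: fps_X_def)
next
  fix i :: nat
  assume "i < 2"
  then have "i = 0 \<or> i = 1" by auto
  then show "fps_nth (fps_exp 1 - 1 - fps_X :: 'a fps) i = 0"
    by auto
qed

lemma hyp_bernoulli2_fps_mult:
  "hyp_bernoulli2_fps x * (fps_exp 1 - 1 - fps_X) =
     fps_const (1 / 2) * fps_X ^ 2 * fps_exp (x :: 'a::field_char_0)"
proof -
  have ne: "fps_exp 1 - 1 - fps_X \<noteq> (0 :: 'a fps)"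
    using subdegree_fps_exp_minus_one_minus_X by (metis subdegree_0 zero_neq_numeral)
  have nz: "fps_const (1 / 2) * fps_X ^ 2 * fps_exp x \<noteq> 0" by simp
  have "subdegree (fps_const (1 / 2) * fps_X ^ 2 * fps_exp x) = 2"
    by simp
  then have "(fps_exp 1 - 1 - fps_X) dvd (fps_const (1 / 2) * fps_X ^ 2 * fps_exp x)"
    by (simp only: fps_dvd_iff[OF ne nz] subdegree_fps_exp_minus_one_minus_X order_refl)
  then show ?thesis unfolding hyp_bernoulli2_fps_def by simp
qed

lemma hyp_bernoulli2_fps_nth:
  "fps_nth (hyp_bernoulli2_fps x) n = hyp_bernoulli2_poly (int n) x / fact n"
  by (simp add: hyp_bernoulli2_poly_def)

end

theory Submission
  imports Defs
begin

text \<open>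
  Write \<open>D = e\<^sup>t - 1 - t\<close>, let \<open>G = (t\<^sup>2/2) / D\<close> be the generating function of the numbers
  \<open>B\<^bsub>2,n\<^esub>\<close>, and let a bar denote the substitution of \<open>-t\<close> for \<open>t\<close>. The left-hand side is
  \<open>n!\<close> times the coefficient of \<open>t\<^sup>n\<close> in the product of \<open>G e\<^bsup>xt\<^esup>\<close> with its reflection; the factors
  \<open>e\<^bsup>xt\<^esup>\<close> and \<open>e\<^bsup>-xt\<^esup>\<close> cancel, so that this product is \<open>G bar(G)\<close>, which is why \<open>x\<close> does not occur
  on the right-hand side. Expanding with \<open>e\<^sup>t e\<^bsup>-t\<^esup> = 1\<close> gives
  \<open>D bar(D) = t\<^sup>2 - (D + bar(D)) + t (D - bar(D))\<close>. Dividing this by \<open>D bar(D)\<close> is a partial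
  fraction decomposition, which after scaling linearises the product:
  \<open>2 G bar(G) = t\<^sup>2/2 + (G + bar(G)) + t (G - bar(G))\<close>
  (lemma \<open>hyp_bernoulli2_fps_mult_reflect_0\<close>). In even degree \<open>n\<close>, the sum \<open>G + bar(G)\<close> doubles the
  coefficient of \<open>G\<close> at \<open>n\<close>, and \<open>G - bar(G)\<close> doubles the one at the odd index \<open>n - 1\<close>.
\<close>

abbreviation fps_reflect :: "'a::comm_ring_1 fps \<Rightarrow> 'a fps" where
  "fps_reflect f \<equiv> f oo (- fps_X)"

lemma fps_nth_reflect: "fps_nth (fps_reflect f) n = (-1) ^ n * fps_nth f n"
  by (simp add: fps_compose_uminus')

lemma hyp_bernoulli2_fps_eq_mult_exp:
  fixes x :: "'a::field_char_0"
  shows "hyp_bernoulli2_fps x = hyp_bernoulli2_fps 0 * fps_exp x"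
proof -
  have ne: "fps_exp 1 - 1 - fps_X \<noteq> (0 :: 'a fps)"
    using subdegree_fps_exp_minus_one_minus_X by (metis subdegree_0 zero_neq_numeral)
  have "hyp_bernoulli2_fps x * (fps_exp 1 - 1 - fps_X) =
        hyp_bernoulli2_fps 0 * fps_exp x * (fps_exp 1 - 1 - fps_X)"
    using hyp_bernoulli2_fps_mult[of x] hyp_bernoulli2_fps_mult[of "0::'a"]
    by (simp add: mult_ac)
  with ne show ?thesis by simp
qed

lemma hyp_bernoulli2_fps_mult_reflect:
  fixes x :: "'a::field_char_0"
  shows "hyp_bernoulli2_fps x * fps_reflect (hyp_bernoulli2_fps x) =
         hyp_bernoulli2_fps 0 * fps_reflect (hyp_bernoulli2_fps 0)"
proof -
  have "fps_exp x * fps_reflect (fps_exp x) = 1"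
    by (simp flip: fps_exp_add_mult)
  then show ?thesis
    by (subst (1 2) hyp_bernoulli2_fps_eq_mult_exp)
       (simp add: fps_compose_mult_distrib mult_ac)
qed

text \<open>
  With \<open>h = t\<^sup>2/2\<close>, multiplication by the nonzero series \<open>D bar(D)\<close> turns \<open>G bar(G)\<close> into \<open>h\<^sup>2\<close>,
  \<open>G\<close> into \<open>h bar(D)\<close> and \<open>bar(G)\<close> into \<open>h D\<close>. The claim thereby becomes \<open>h\<close> times the expansion
  of \<open>D bar(D)\<close>; the sign of the last summand changes because \<open>G\<close> goes with \<open>bar(D)\<close>.
\<close>
lemma hyp_bernoulli2_fps_mult_reflect_0:
  defines "G \<equiv> hyp_bernoulli2_fps (0 :: 'a::field_char_0)"
  shows "2 * (G * fps_reflect G) =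
         fps_const (1 / 2) * fps_X ^ 2 + (G + fps_reflect G) + fps_X * (G - fps_reflect G)"
proof -
  define E where "E = fps_exp (1 :: 'a)"
  define E' where "E' = fps_exp (- 1 :: 'a)"
  define D where "D = E - 1 - fps_X"
  define D' where "D' = E' - 1 + fps_X"
  define h :: "'a fps" where "h = fps_const (1 / 2) * fps_X ^ 2"
  define G' where "G' = fps_reflect G"
  have refl_E: "fps_reflect E = E'"
    by (simp add: E_def E'_def)
  have refl_D: "fps_reflect D = D'"
    by (simp add: D_def D'_def fps_compose_sub_distrib refl_E)
  have refl_h: "fps_reflect h = h"
    by (simp add: h_def fps_compose_mult_distrib fps_compose_power[symmetric])
  have GD: "G * D = h"
    using hyp_bernoulli2_fps_mult[of "0::'a"] by (simp add: G_def D_def E_def h_def)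
  then have "fps_reflect (G * D) = fps_reflect h" by simp
  then have GD': "G' * D' = h"
    by (simp add: fps_compose_mult_distrib refl_D refl_h G'_def)
  have EE': "E * E' = 1"
    by (simp add: E_def E'_def flip: fps_exp_add_mult)
  have two_h: "2 * h = fps_X ^ 2"
    by (simp add: h_def fps_numeral_fps_const flip: mult.assoc)
  have DD': "D * D' = fps_X ^ 2 - (D + D') + fps_X * (D - D')"
    using EE' by (simp add: D_def D'_def algebra_simps power2_eq_square)
  have ne: "D \<noteq> 0"
    using subdegree_fps_exp_minus_one_minus_X unfolding D_def E_def
    by (metis subdegree_0 zero_neq_numeral)
  have "h \<noteq> 0" by (simp add: h_def)
  with GD' have ne': "D' \<noteq> 0" by auto
  (* Here h = G D = bar(G) bar(D), so the factor 2 h = t^2 can be traded for the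
     other terms of the expansion of D bar(D). *)
  have "2 * (G * G') * (D * D') = 2 * ((G * D) * (G' * D'))"
    by (simp add: mult_ac)
  also have "\<dots> = (2 * h) * h"
    unfolding GD GD' by (simp add: mult.assoc)
  also have "\<dots> = h * (D * D' + (D + D') - fps_X * (D - D'))"
    unfolding two_h DD' by (simp add: mult_ac)
  also have "\<dots> = h * (D * D') + ((G * D) * D' + (G' * D') * D) + fps_X * ((G * D) * D' - (G' * D') * D)"
    unfolding GD GD' by (simp add: algebra_simps)
  also have "\<dots> = (h + (G + G') + fps_X * (G - G')) * (D * D')"
    by (simp add: algebra_simps)
  finally show ?thesis
    using ne ne' by (simp add: h_def G'_def)
qed

theorem corollary9:
  fixes n :: nat and x :: "'a::field_char_0"
  assumes "even n"
  shows "(\<Sum>k=0..n. (-1) ^ k * of_nat (n choose k) *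
            hyp_bernoulli2_poly (int n - int k) x * hyp_bernoulli2_poly (int k) x) =
         1 / 2 * delta (int n - 2) + of_nat n * hyp_bernoulli2 (int n - 1) + hyp_bernoulli2 (int n)"
proof -
  define F where "F = hyp_bernoulli2_fps x"
  define G where "G = hyp_bernoulli2_fps (0 :: 'a)"
  define b where "b = fps_nth G"
  have "(\<Sum>k=0..n. (-1) ^ k * of_nat (n choose k) *
            hyp_bernoulli2_poly (int n - int k) x * hyp_bernoulli2_poly (int k) x) =
        (\<Sum>k=0..n. fact n * (fps_nth (fps_reflect F) k * fps_nth F (n - k)))"
  proof (rule sum.cong)
    fix k assume "k \<in> {0..n}"
    then have k: "k \<le> n" by simp
    then have "nat (int n - int k) = n - k" by simp
    with k show "(-1) ^ k * of_nat (n choose k) *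
            hyp_bernoulli2_poly (int n - int k) x * hyp_bernoulli2_poly (int k) x =
          fact n * (fps_nth (fps_reflect F) k * fps_nth F (n - k))"
      by (simp add: hyp_bernoulli2_poly_def F_def fps_nth_reflect binomial_fact)
  qed simp
  also have "\<dots> = fact n * fps_nth (F * fps_reflect F) n"
    by (simp add: mult.commute[of F] fps_mult_nth sum_distrib_left)
  also have "F * fps_reflect F = G * fps_reflect G"
    unfolding F_def G_def by (rule hyp_bernoulli2_fps_mult_reflect)
  finally have lhs: "(\<Sum>k=0..n. (-1) ^ k * of_nat (n choose k) *
            hyp_bernoulli2_poly (int n - int k) x * hyp_bernoulli2_poly (int k) x) =
        fact n * fps_nth (G * fps_reflect G) n" .
  have "fps_nth (2 * (G * fps_reflect G)) n =
        fps_nth (fps_const (1 / 2) * fps_X ^ 2 + (G + fps_reflect G) + fps_X * (G - fps_reflect G)) n"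
    unfolding G_def by (simp only: hyp_bernoulli2_fps_mult_reflect_0)
  then have coeff: "2 * fps_nth (G * fps_reflect G) n =
        2 * ((if n = 2 then 1 / 4 else 0) + b n + (if n = 0 then 0 else b (n - 1)))"
    using \<open>even n\<close> by (simp add: fps_nth_reflect b_def fps_X_power_nth numeral_fps_const)
  (* For n = 0 the index n - 1 is negative; on both sides the term vanishes. *)
  have pred: "of_nat n * hyp_bernoulli2 (int n - 1) =
        fact n * (if n = 0 then 0 else b (n - 1))"
  proof (cases n)
    case (Suc m)
    then show ?thesis
      by (simp add: hyp_bernoulli2_def hyp_bernoulli2_poly_def b_def G_def)
  qed simp
  have same: "hyp_bernoulli2 (int n) = fact n * b n"
    by (simp add: hyp_bernoulli2_def hyp_bernoulli2_poly_def b_def G_def)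
  have delta: "1 / 2 * delta (int n - 2) = fact n * (if n = 2 then 1 / 4 else (0 :: 'a))"
    by (auto simp: delta_def fact_2)
  from coeff have "fps_nth (G * fps_reflect G) n =
        (if n = 2 then 1 / 4 else 0) + b n + (if n = 0 then 0 else b (n - 1))"
    by (subst (asm) mult_left_cancel) simp_all
  then show ?thesis
    unfolding lhs pred same delta by (simp add: algebra_simps)
qed

end
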